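(* Let $P\in\mathcal{C}(G_n)$. If $A, B \in \mathrm{char}(P)$, then $A\subseteq B$ or $B\subseteq A$.
   Context: Let $Q_n=\{1,\dots,n\}$ be a set of $n$ yes/no questions. An outcome on a set $S\subseteq Q_n$ is an element of $\{0,1\}^{|S|}$, and $X_S$ denotes the set of all outcomes on $S$. A preference matrix on $Q_n$ is a $2^n\times n$ matrix with entries in $\{0,1\}$ whose rows are the $2^n$ outcomes on $Q_n$, each appearing exactly once, ordered from most preferred (top) to least preferred (bottom). For a nonempty proper subset $S\subset Q_n$ and an outcome $x$ on $Q_n-S$, $P^{[Q_n-S,x]}$ denotes the submatrix of $P$ formed by the columns indexed by $S$ and the rows of $P$ whose outcome on $Q_n-S$ is $x$ (in the order they appear in $P$). $S$ is separable with respect to $P$ if $P^{[Q_n-S,x]}=P^{[Q_n-S,y]}$ for all $x,y\in X_{Q_n-S}$; $\emptyset$ and $Q_n$ are always considered separable. The character $\mathrm{char}(P)$ is the set of all subsets of $Q_n$ that are separable with respect to $P$. $G_n$ denotes the $n$-dimensional hypercube graph whose $2^n$ vertices are labeled by the outcomes in $\{0,1\}^n$ so that adjacent vertices differ in exactly one bit (Gray code labeling); $\mathcal{C}(G_n)$ is the set of preference matrices whose rows, top to bottom, list the vertex labels in the order traversed by some Hamiltonian path of $G_n$ (equivalently, preference matrices in which consecutive rows differ in exactly one entry). Elements of $\mathcal{C}(G_n)$ are called cubic preferences. *)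

theory Defs
  imports "HOL-Library.FuncSet" "Graph_Theory.Graph_Theory"
begin

text \<open>
  Questions are the numbers \<open>1, \<dots>, n\<close>.  An outcome on a set \<open>S\<close> of questions is a vector of
  0/1 answers indexed by \<open>S\<close> itself rather than by \<open>1, \<dots>, card S\<close>, i.e. an extensional function
  on \<open>S\<close>; the part of an outcome \<open>r\<close> lying on \<open>S\<close> is then \<open>restrict r S\<close>.
\<close>

type_synonym outcome = "nat \<Rightarrow> nat"

definition questions :: "nat \<Rightarrow> nat set" where
  "questions n = {1..n}"

definition outcomes :: "nat set \<Rightarrow> outcome set" where
  "outcomes S = S \<rightarrow>\<^sub>E {0, 1}"

text \<open>A matrix is the list of its rows from top to bottom; each row maps column indices to entries.\<close>

definition preference_matrix :: "nat \<Rightarrow> outcome list \<Rightarrow> bool" where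
  "preference_matrix n P \<longleftrightarrow> distinct P \<and> set P = outcomes (questions n)"

text \<open>
  \<open>submatrix P T x S\<close>: the columns in \<open>S\<close> of those rows of \<open>P\<close> whose part on \<open>T\<close> is \<open>x\<close>,
  in the order of \<open>P\<close>.  The matrix \<open>P\<close> with superscript \<open>[Q - S, x]\<close> is \<open>submatrix P (Q - S) x S\<close>.
\<close>

definition submatrix :: "outcome list \<Rightarrow> nat set \<Rightarrow> outcome \<Rightarrow> nat set \<Rightarrow> outcome list" where
  "submatrix P T x S = map (\<lambda>r. restrict r S) (filter (\<lambda>r. restrict r T = x) P)"

definition separable :: "nat \<Rightarrow> outcome list \<Rightarrow> nat set \<Rightarrow> bool" where
  "separable n P S \<longleftrightarrow>
     S = {} \<or> S = questions n \<or>
     (S \<subseteq> questions n \<and>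
      (\<forall>x \<in> outcomes (questions n - S). \<forall>y \<in> outcomes (questions n - S).
         submatrix P (questions n - S) x S = submatrix P (questions n - S) y S))"

definition character :: "nat \<Rightarrow> outcome list \<Rightarrow> nat set set" where
  "character n P = {S. S \<subseteq> questions n \<and> separable n P S}"

text \<open>
  The hypercube as a symmetric digraph, which is how \<open>Graph_Theory\<close> represents undirected graphs;
  every vertex is its own (Gray code) label.
\<close>

definition hypercube :: "nat \<Rightarrow> outcome pair_pre_digraph" where
  "hypercube n = \<lparr>
     pverts = outcomes (questions n),
     parcs = {(u, v). u \<in> outcomes (questions n) \<and> v \<in> outcomes (questions n) \<and>
                      card {q \<in> questions n. u q \<noteq> v q} = 1} \<rparr>"

definition hamiltonian_path :: "('a, 'b) pre_digraph \<Rightarrow> 'a list \<Rightarrow> bool" where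
  "hamiltonian_path G p \<longleftrightarrow> vpath p G \<and> set p = verts G"

definition cubic_preferences :: "nat \<Rightarrow> outcome list set" where
  "cubic_preferences n =
     {P. preference_matrix n P \<and> hamiltonian_path (with_proj (hypercube n)) P}"

lemma finite_outcomes: "finite S \<Longrightarrow> finite (outcomes S)"
  by (simp add: outcomes_def finite_PiE)

lemma card_outcomes: "finite S \<Longrightarrow> card (outcomes S) = 2 ^ card S"
  by (simp add: outcomes_def card_PiE numeral_2_eq_2)

lemma preference_matrix_length: "preference_matrix n P \<Longrightarrow> length P = 2 ^ n"
  using distinct_card[of P] card_outcomes[of "questions n"]
  by (simp add: preference_matrix_def questions_def)

lemma hypercube_pair_graph: "pair_graph (hypercube n)"
proof
  show "finite (pverts (hypercube n))"
    by (simp add: hypercube_def finite_outcomes questions_def)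
  have "parcs (hypercube n) \<subseteq> outcomes (questions n) \<times> outcomes (questions n)"
    by (auto simp: hypercube_def)
  then show "finite (parcs (hypercube n))"
    by (rule finite_subset) (simp add: finite_outcomes questions_def)
  show "symmetric (with_proj (hypercube n))"
    unfolding symmetric_def with_proj_simps
    by (rule symI) (simp add: hypercube_def eq_commute)
qed (auto simp: hypercube_def)

lemma set_vwalk_arcs: "set (vwalk_arcs p) = {(p ! i, p ! Suc i) |i. Suc i < length p}"
proof (induction p rule: vwalk_arcs.induct)
  case (3 x y xs)
  let ?s = "\<lambda>p. {(p ! i, p ! Suc i) |i. Suc i < length p}"
  have "?s (x # y # xs) = insert (x, y) (?s (y # xs))" (is "?L = ?R")
  proof
    show "?L \<subseteq> ?R"
    proof
      fix e assume "e \<in> ?L"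
      then obtain i where "e = ((x # y # xs) ! i, (x # y # xs) ! Suc i)" "i < Suc (length xs)"
        by auto
      then show "e \<in> ?R" by (cases i) auto
    qed
    have "(x, y) \<in> ?L" by (rule CollectI, rule exI[of _ 0]) simp
    moreover have "?s (y # xs) \<subseteq> ?L"
    proof
      fix e assume "e \<in> ?s (y # xs)"
      then obtain i where "e = ((y # xs) ! i, (y # xs) ! Suc i)" "Suc i < length (y # xs)"
        by blast
      then show "e \<in> ?L" by (intro CollectI exI[of _ "Suc i"]) simp
    qed
    ultimately show "?R \<subseteq> ?L" by blast
  qed
  with 3 show ?case by (simp only: vwalk_arcs.simps list.set)
qed simp_all

lemma cubic_preferences_iff:
  "P \<in> cubic_preferences n \<longleftrightarrow>
     preference_matrix n P \<and>
     (\<forall>i. Suc i < length P \<longrightarrow> card {q \<in> questions n. (P ! i) q \<noteq> (P ! Suc i) q} = 1)"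
proof (cases "preference_matrix n P")
  case True
  then have "P \<noteq> []" using preference_matrix_length by fastforce
  have P: "distinct P" "set P = outcomes (questions n)"
    using True by (simp_all add: preference_matrix_def)
  have "set (vwalk_arcs P) \<subseteq> parcs (hypercube n) \<longleftrightarrow>
      (\<forall>i. Suc i < length P \<longrightarrow> (P ! i, P ! Suc i) \<in> parcs (hypercube n))"
    unfolding set_vwalk_arcs by blast
  also have "\<dots> \<longleftrightarrow>
      (\<forall>i. Suc i < length P \<longrightarrow> card {q \<in> questions n. (P ! i) q \<noteq> (P ! Suc i) q} = 1)"
    using nth_mem[of _ P] by (simp add: hypercube_def P(2))
  finally show ?thesis
    using True P \<open>P \<noteq> []\<close>
    by (simp add: cubic_preferences_def hamiltonian_path_def vpath_def vwalk_def)
      (simp add: hypercube_def)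
qed (simp add: cubic_preferences_def)

end

theory Submission
  imports Defs
begin

text \<open>
  If \<open>S\<close> is separable, then all submatrices on the columns \<open>S\<close> are one and the same ranking of the
  outcomes on \<open>S\<close>.  A step of the Hamiltonian path flips one bit: it either leaves the part on
  \<open>S\<close> unchanged, or keeps the part off \<open>S\<close> fixed and hence moves down in that common ranking.  So
  the part on \<open>S\<close> never returns to a value it has left.  Now suppose that \<open>a \<in> A - B\<close> and
  \<open>b \<in> B - A\<close>.  Flipping \<open>a\<close> in the first row gives a row with the same part on \<open>B\<close>, so the
  part on \<open>B\<close> is constant up to it; flipping \<open>b\<close> gives a row up to which the part on \<open>A\<close> is
  constant.  Whichever of the two rows comes first contradicts the constancy up to the other.
\<close>

lemma nth_length_takeWhile_neq:
  assumes "x \<in> set xs"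
  shows "xs ! length (takeWhile (\<lambda>y. y \<noteq> x) xs) = x"
proof -
  have "length (takeWhile (\<lambda>y. y \<noteq> x) xs) < length xs"
    using assms by (induction xs) auto
  then show ?thesis
    using nth_length_takeWhile by fastforce
qed

lemma outcome_restrict:
  "r \<in> outcomes Q \<Longrightarrow> T \<subseteq> Q \<Longrightarrow> restrict r T \<in> outcomes T"
  by (auto simp: outcomes_def PiE_iff)

lemma outcome_eqI:
  assumes "r \<in> outcomes Q" "s \<in> outcomes Q"
    and "restrict r S = restrict s S" "restrict r (Q - S) = restrict s (Q - S)"
  shows "r = s"
proof (rule PiE_ext)
  show "r \<in> Q \<rightarrow>\<^sub>E {0, 1}" "s \<in> Q \<rightarrow>\<^sub>E {0, 1}"
    using assms by (simp_all add: outcomes_def)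
  show "r q = s q" if "q \<in> Q" for q
    using that assms(3,4) by (metis Diff_iff restrict_apply')
qed

text \<open>The selected rows share the part \<open>x\<close> off \<open>S\<close>, so two of them
  that also agree on \<open>S\<close> are the same row of \<open>P\<close>.\<close>

lemma distinct_submatrix:
  assumes "preference_matrix n P"
  shows "distinct (submatrix P (questions n - S) x S)"
proof -
  have "inj_on (\<lambda>r. restrict r S) {r \<in> outcomes (questions n). restrict r (questions n - S) = x}"
    by (rule inj_onI) (metis (mono_tags, lifting) mem_Collect_eq outcome_eqI)
  then show ?thesis
    using assms by (simp add: submatrix_def preference_matrix_def distinct_map)
qed

text \<open>The one flipped question lies in \<open>S\<close>, so the filter for \<open>x\<close>
  keeps both rows. Nothing stands between them in \<open>P\<close>, hence nothing does in the
  submatrix.\<close>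

lemma path_step_in_submatrix:
  assumes P: "P \<in> cubic_preferences n" and i: "Suc i < length P"
    and neq: "restrict (P ! Suc i) S \<noteq> restrict (P ! i) S"
  defines "x \<equiv> restrict (P ! i) (questions n - S)"
  obtains xs ys where
    "submatrix P (questions n - S) x S = xs @ restrict (P ! i) S # restrict (P ! Suc i) S # ys"
proof -
  let ?D = "{q \<in> questions n. (P ! i) q \<noteq> (P ! Suc i) q}"
  have pm: "preference_matrix n P" and "card ?D = 1"
    using P i by (auto simp: cubic_preferences_iff)
  then obtain d where d: "?D = {d}"
    by (auto simp: card_1_singleton_iff)
  have rows: "P ! i \<in> outcomes (questions n)" "P ! Suc i \<in> outcomes (questions n)"
    using pm i unfolding preference_matrix_def by (metis Suc_lessD nth_mem)+
  obtain q where "q \<in> S" "(P ! Suc i) q \<noteq> (P ! i) q"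
    using neq by (meson restrict_ext)
  \<comment> \<open>\<open>S\<close> is arbitrary here, but outcomes are extensional: off the
    questions both rows take the same default value.\<close>
  moreover from this have "q \<in> questions n"
    using rows by (metis PiE_arb outcomes_def)
  ultimately have "d \<in> S"
    using d by (metis (mono_tags, lifting) mem_Collect_eq singletonD)
  have "(P ! Suc i) r = (P ! i) r" if "r \<in> questions n - S" for r
    using that d \<open>d \<in> S\<close> by (metis (mono_tags, lifting) DiffE mem_Collect_eq singletonD)
  then have x: "restrict (P ! Suc i) (questions n - S) = x"
    unfolding x_def by (rule restrict_ext)
  let ?us = "take i P" and ?vs = "drop (Suc (Suc i)) P"
  have "P = ?us @ P ! i # P ! Suc i # ?vs"
    using i by (simp add: Cons_nth_drop_Suc)
  then have "submatrix P (questions n - S) x S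
      = submatrix (?us @ P ! i # P ! Suc i # ?vs) (questions n - S) x S"
    by (rule arg_cong)
  also have "\<dots> = submatrix ?us (questions n - S) x S @ restrict (P ! i) S # restrict (P ! Suc i) S
        # submatrix ?vs (questions n - S) x S"
    using x by (simp add: submatrix_def x_def)
  finally show thesis by (rule that)
qed

lemma separable_part_constant:
  assumes P: "P \<in> cubic_preferences n" and S: "S \<in> character n P" "S \<noteq> {}" "S \<noteq> questions n"
    and "i \<le> j" "j \<le> k" and k: "k < length P"
    and eq: "restrict (P ! i) S = restrict (P ! k) S"
  shows "restrict (P ! j) S = restrict (P ! i) S"
proof -
  let ?L = "\<lambda>x. submatrix P (questions n - S) x S"
  let ?part = "\<lambda>m. restrict (P ! m) (questions n - S)"
  define L where "L = ?L (?part i)"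
  \<comment> \<open>The position of the part of row \<open>m\<close> in the common ranking
    \<open>L\<close>, as the length of the prefix before its first occurrence.\<close>
  define rank where "rank = (\<lambda>m. length (takeWhile (\<lambda>y. y \<noteq> restrict (P ! m) S) L))"
  have pm: "preference_matrix n P"
    using P by (simp add: cubic_preferences_iff)
  have part: "?part m \<in> outcomes (questions n - S)" if "m < length P" for m
    using pm that unfolding preference_matrix_def by (metis Diff_subset nth_mem outcome_restrict)
  have L: "?L (?part m) = L" if "m < length P" for m
  proof -
    have "i < length P"
      using assms(5,6) k by simp
    moreover have "separable n P S"
      using S by (simp add: character_def)
    ultimately show ?thesis
      unfolding L_def separable_def using S(2,3) part that by blast
  qed
  have mem: "restrict (P ! m) S \<in> set L" if "m < length P" for m
    using that by (subst L[OF that, symmetric]) (auto simp: submatrix_def)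
  have step: "rank m \<le> rank (Suc m)" if m: "Suc m < length P" for m
  proof (cases "restrict (P ! Suc m) S = restrict (P ! m) S")
    case True
    then show ?thesis by (simp add: rank_def)
  next
    case False
    then obtain xs ys where "?L (?part m) = xs @ restrict (P ! m) S # restrict (P ! Suc m) S # ys"
      by (rule path_step_in_submatrix[OF P m])
    then have eqL: "L = xs @ restrict (P ! m) S # restrict (P ! Suc m) S # ys"
      using L m by simp
    \<comment> \<open>\<open>L\<close> has no repeated entry, so \<open>takeWhile\<close> stops
      exactly at the two displayed positions.\<close>
    then have "restrict (P ! m) S \<notin> set xs" "restrict (P ! Suc m) S \<notin> set xs"
      using distinct_submatrix[OF pm, of S "?part i"] unfolding L_def by auto
    then have "rank m = length xs" "rank (Suc m) = Suc (length xs)"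
      unfolding rank_def eqL using False by (subst takeWhile_append2; auto)+
    then show ?thesis by simp
  qed
  have mono: "rank l \<le> rank m" if "l \<le> m" "m < length P" for l m
    using that
  proof (induction m rule: dec_induct)
    case (step m)
    then show ?case using \<open>\<And>m. Suc m < length P \<Longrightarrow> rank m \<le> rank (Suc m)\<close>[of m] by simp
  qed simp
  \<comment> \<open>The ranks at \<open>i\<close> and \<open>k\<close> coincide, so monotonicity
    squeezes the rank at \<open>j\<close>; equal positions in \<open>L\<close> hold equal
    parts.\<close>
  have "rank i \<le> rank j" "rank j \<le> rank k"
    using mono assms(5,6) k by simp_all
  moreover have "rank k = rank i"
    using eq by (simp add: rank_def)
  ultimately have "rank j = rank i" by simp
  moreover have "L ! rank i = restrict (P ! i) S" "L ! rank j = restrict (P ! j) S"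
    unfolding rank_def using assms(5,6) k by (simp_all add: nth_length_takeWhile_neq mem)
  ultimately show ?thesis by simp
qed

text \<open>Every outcome is a row of \<open>P\<close>, in particular the top row with its answer to
  \<open>q\<close> flipped.\<close>

lemma flipped_row:
  assumes pm: "preference_matrix n P" and q: "q \<in> questions n"
  obtains k where "k < length P" "(P ! k) q \<noteq> (P ! 0) q"
    "\<And>S. q \<notin> S \<Longrightarrow> restrict (P ! k) S = restrict (P ! 0) S"
proof -
  let ?r = "(P ! 0)(q := 1 - (P ! 0) q)"
  have "P ! 0 \<in> outcomes (questions n)"
    using pm preference_matrix_length[OF pm] unfolding preference_matrix_def
    by (metis nth_mem pos2 zero_less_power)
  then have r0: "P ! 0 \<in> questions n \<rightarrow>\<^sub>E {0, 1}"
    by (simp add: outcomes_def)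
  then have "?r \<in> set P"
    using pm q by (auto simp: preference_matrix_def outcomes_def PiE_iff extensional_def)
  then obtain k where k: "k < length P" "P ! k = ?r"
    by (meson in_set_conv_nth)
  moreover have "(P ! k) q \<noteq> (P ! 0) q"
    using k PiE_mem[OF r0 q] by auto
  moreover have "restrict (P ! k) S = restrict (P ! 0) S" if "q \<notin> S" for S
    unfolding k(2) using that by (intro restrict_ext) auto
  ultimately show thesis by (intro that)
qed

theorem theorem3:
  fixes n :: nat and P :: "outcome list" and A B :: "nat set"
  assumes "P \<in> cubic_preferences n"
    and "A \<in> character n P" and "B \<in> character n P"
  shows "A \<subseteq> B \<or> B \<subseteq> A"
proof (rule ccontr)
  assume "\<not> (A \<subseteq> B \<or> B \<subseteq> A)"
  then obtain a b where ab: "a \<in> A" "a \<notin> B" "b \<in> B" "b \<notin> A"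
    by blast
  have sub: "A \<subseteq> questions n" "B \<subseteq> questions n"
    using assms by (simp_all add: character_def)
  \<comment> \<open>The witnesses \<open>a\<close> and \<open>b\<close> rule out the two sets that
    are separable by convention.\<close>
  with ab have proper: "A \<noteq> {}" "B \<noteq> {}" "A \<noteq> questions n" "B \<noteq> questions n"
    by auto
  have pm: "preference_matrix n P"
    using assms by (simp add: cubic_preferences_iff)
  obtain k where k: "k < length P" "(P ! k) a \<noteq> (P ! 0) a"
      "restrict (P ! k) B = restrict (P ! 0) B"
    using flipped_row[OF pm, of a] ab sub by (metis subsetD)
  obtain l where l: "l < length P" "(P ! l) b \<noteq> (P ! 0) b"
      "restrict (P ! l) A = restrict (P ! 0) A"
    using flipped_row[OF pm, of b] ab sub by (metis subsetD)
  show False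
  proof (cases "k \<le> l")
    case True
    \<comment> \<open>Row \<open>k\<close> lies between rows \<open>0\<close> and \<open>l\<close>,
      which agree on \<open>A\<close>, yet it differs from row \<open>0\<close> at
      \<open>a\<close>.\<close>
    have "restrict (P ! k) A = restrict (P ! 0) A"
      using separable_part_constant[OF assms(1,2) proper(1,3) le0 True l(1) l(3)[symmetric]] .
    then show False using k(2) ab(1) by (metis restrict_apply')
  next
    case False
    then have "l \<le> k" by simp
    then have "restrict (P ! l) B = restrict (P ! 0) B"
      using separable_part_constant[OF assms(1,3) proper(2,4) le0 _ k(1) k(3)[symmetric]] by blast
    then show False using l(2) ab(3) by (metis restrict_apply')
  qed
qed

end
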